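(* Let $k\ge 2$ be a natural number and let $S$ be a $k$-automatic subset of $\mathbb{N}$. A necessary condition for $S$ to be an additive basis for $\mathbb{N}$ is that $1\in S$. If $S$ is not sparse, $\gcd(S)=1$, and $1\in S$, then $S$ is an additive basis for $\mathbb{N}$, and these conditions are necessary.
   Context: $\mathbb{N}$ denotes the set of natural numbers (including $0$). The canonical base-$k$ expansion of $n\in\mathbb{N}$ is the unique word over $\{0,1,\ldots,k-1\}$ representing $n$ in base $k$ without leading zeros. A set $S\subseteq\mathbb{N}$ is $k$-automatic if the language of canonical base-$k$ expansions of its elements is regular, i.e., accepted by a deterministic finite automaton. $S$ is an additive basis for $\mathbb{N}$ if there exists a constant $j$ such that every natural number can be written as a sum of at most $j$ members of $S$. Let $\pi_S(x)=\#\{n\le x : n\in S\}$. $S$ is sparse if there is an integer $d\ge 0$ with $\pi_S(x)=O((\log x)^d)$. $\gcd(S)$ is the greatest common divisor of all elements of $S$. *)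

theory Defs
  imports Complex_Main "HOL-Library.Landau_Symbols"
begin

record ('q, 'a) dfa =
  states :: "'q set"
  init :: 'q
  trans :: "'q \<Rightarrow> 'a \<Rightarrow> 'q"
  final :: "'q set"

definition wf_dfa :: "'a set \<Rightarrow> ('q, 'a) dfa \<Rightarrow> bool" where
  "wf_dfa \<Sigma> M \<longleftrightarrow>
     finite (states M) \<and> init M \<in> states M \<and> final M \<subseteq> states M \<and>
     (\<forall>q\<in>states M. \<forall>a\<in>\<Sigma>. trans M q a \<in> states M)"

definition accepted :: "'a set \<Rightarrow> ('q, 'a) dfa \<Rightarrow> 'a list set" where
  "accepted \<Sigma> M = {w \<in> lists \<Sigma>. foldl (trans M) (init M) w \<in> final M}"

(* HOL cannot quantify existentially over the type of states; since the state set is finite,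
   states may be taken to be natural numbers (see regularI below). *)
definition regular :: "'a set \<Rightarrow> 'a list set \<Rightarrow> bool" where
  "regular \<Sigma> L \<longleftrightarrow> (\<exists>M :: (nat, 'a) dfa. wf_dfa \<Sigma> M \<and> accepted \<Sigma> M = L)"

lemma regularI:
  fixes M :: "('q, 'a) dfa"
  assumes wf: "wf_dfa \<Sigma> M" and L: "accepted \<Sigma> M = L"
  shows "regular \<Sigma> L"
proof -
  from wf have fin: "finite (states M)" and ini: "init M \<in> states M"
    and fnl: "final M \<subseteq> states M"
    and tr: "\<And>q a. q \<in> states M \<Longrightarrow> a \<in> \<Sigma> \<Longrightarrow> trans M q a \<in> states M"
    by (auto simp: wf_dfa_def)
  obtain f :: "'q \<Rightarrow> nat" where f: "inj_on f (states M)"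
    using finite_imp_inj_to_nat_seg[OF fin] by blast
  define g where "g = inv_into (states M) f"
  have gf: "g (f q) = q" if "q \<in> states M" for q
    using f that by (simp add: g_def)
  define N :: "(nat, 'a) dfa" where
    "N = \<lparr>states = f ` states M, init = f (init M),
          trans = (\<lambda>n a. f (trans M (g n) a)), final = f ` final M\<rparr>"
  have wfN: "wf_dfa \<Sigma> N"
    using fin ini fnl tr by (auto simp: wf_dfa_def N_def gf)
  have run: "foldl (trans N) (f q) w = f (foldl (trans M) q w) \<and> foldl (trans M) q w \<in> states M"
    if "q \<in> states M" "w \<in> lists \<Sigma>" for q w
    using that by (induction w arbitrary: q) (simp_all add: N_def gf tr)
  have "foldl (trans N) (init N) w \<in> final N \<longleftrightarrow> foldl (trans M) (init M) w \<in> final M"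
    if "w \<in> lists \<Sigma>" for w
  proof -
    have "foldl (trans N) (init N) w = f (foldl (trans M) (init M) w)"
      using run[OF ini that] by (simp add: N_def)
    moreover have "foldl (trans M) (init M) w \<in> states M"
      using run[OF ini that] by simp
    ultimately show ?thesis
      using fnl inj_on_image_mem_iff[OF f] by (simp add: N_def)
  qed
  then have "accepted \<Sigma> N = accepted \<Sigma> M"
    by (auto simp: accepted_def)
  with wfN L show ?thesis
    by (auto simp: regular_def)
qed

(* Words are written most significant digit first; horner_sum expects the least significant
   digit first. The canonical expansion of 0 is the empty word. *)
definition canonical_word :: "nat \<Rightarrow> nat \<Rightarrow> nat list \<Rightarrow> bool" where
  "canonical_word k n w \<longleftrightarrow>
     w \<in> lists {..<k} \<and> (w \<noteq> [] \<longrightarrow> hd w \<noteq> 0) \<and> horner_sum of_nat k (rev w) = n"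

definition canonical_expansion :: "nat \<Rightarrow> nat \<Rightarrow> nat list" where
  "canonical_expansion k n = (THE w. canonical_word k n w)"

lemma canonical_word_snoc:
  assumes k: "k \<ge> 2"
  shows "canonical_word k n (w @ [d]) \<longleftrightarrow> n > 0 \<and> d = n mod k \<and> canonical_word k (n div k) w"
proof
  assume *: "canonical_word k n (w @ [d])"
  then have d: "d < k" and n: "n = d + k * horner_sum of_nat k (rev w)"
    by (auto simp: canonical_word_def)
  have w: "canonical_word k (horner_sum of_nat k (rev w)) w"
    using * by (auto simp: canonical_word_def hd_append split: if_splits)
  have pos: "n > 0"
  proof (cases w rule: list.exhaust)
    case Nil
    with * n show ?thesis by (simp add: canonical_word_def)
  next
    case (Cons a v)
    then have "a > 0" using * by (simp add: canonical_word_def)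
    then have "horner_sum of_nat k (rev w) > (0::nat)"
      using k Cons by (simp add: horner_sum_append)
    then show ?thesis using n k by simp
  qed
  show "n > 0 \<and> d = n mod k \<and> canonical_word k (n div k) w"
    using d n w pos by simp
next
  assume *: "n > 0 \<and> d = n mod k \<and> canonical_word k (n div k) w"
  have "d \<noteq> 0" if "w = []"
  proof -
    from that * have "n div k = 0" by (auto simp: canonical_word_def)
    then show ?thesis using * k by (simp add: div_eq_0_iff)
  qed
  then show "canonical_word k n (w @ [d])"
    using * k by (auto simp: canonical_word_def hd_append)
qed

lemma canonical_word_ex1:
  assumes "k \<ge> 2"
  shows "\<exists>!w. canonical_word k n w"
proof (induction n rule: less_induct)
  case (less n)
  show ?case
  proof (cases "n = 0")
    case True
    have "w = []" if "canonical_word k 0 w" for w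
      using that canonical_word_snoc[OF assms, of 0] by (cases w rule: rev_cases) auto
    then show ?thesis
      using True by (auto simp: canonical_word_def intro!: ex1I[of _ "[]"])
  next
    case False
    then have "n div k < n" using assms by simp
    from less[OF this] obtain v where v: "canonical_word k (n div k) v"
      and uniq: "\<And>w. canonical_word k (n div k) w \<Longrightarrow> w = v" by blast
    show ?thesis
    proof (rule ex1I[of _ "v @ [n mod k]"])
      show "canonical_word k n (v @ [n mod k])"
        using v False canonical_word_snoc[OF assms] by simp
    next
      fix w assume w: "canonical_word k n w"
      then have "w \<noteq> []" using False by (auto simp: canonical_word_def)
      then obtain u d where "w = u @ [d]" by (cases w rule: rev_cases) auto
      then show "w = v @ [n mod k]"
        using w uniq canonical_word_snoc[OF assms] by simp
    qed
  qed
qed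

lemma canonical_word_canonical_expansion:
  "k \<ge> 2 \<Longrightarrow> canonical_word k n (canonical_expansion k n)"
  unfolding canonical_expansion_def by (rule theI'[OF canonical_word_ex1])

definition automatic :: "nat \<Rightarrow> nat set \<Rightarrow> bool" where
  "automatic k S \<longleftrightarrow> regular {..<k} (canonical_expansion k ` S)"

(* The list may repeat elements of S, and the empty sum represents 0. *)
definition additive_basis :: "nat set \<Rightarrow> bool" where
  "additive_basis S \<longleftrightarrow>
     (\<exists>j. \<forall>n. \<exists>xs. set xs \<subseteq> S \<and> length xs \<le> j \<and> sum_list xs = n)"

definition counting :: "nat set \<Rightarrow> real \<Rightarrow> nat" where
  "counting S x = card {n \<in> S. real n \<le> x}"

definition sparse :: "nat set \<Rightarrow> bool" where
  "sparse S \<longleftrightarrow> (\<exists>d::nat. (\<lambda>x. real (counting S x)) \<in> O[at_top](\<lambda>x. ln x ^ d))"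

end

theory Submission
  imports Defs
begin

text \<open>
  Necessity is counting: with only polylogarithmically many elements of \<open>S\<close> up to \<open>x\<close> there are too few
  sums of \<open>j\<close> of them to reach all numbers up to \<open>x\<close>. For sufficiency, if no useful state of the automaton carries two
  distinct loops of the same length, then splitting words at the last visit to a state shows that
  polynomially many words of each length are accepted, so \<open>S\<close> is sparse. Otherwise let
  \<open>v\<close> and \<open>w\<close> be such loops, and \<open>K = k\<^sup>|\<^sup>v\<^sup>|\<close>. Then \<open>S\<close> contains all numbers
  with expansion \<open>u x\<^sub>1 \<dots> x\<^sub>n z\<close> where each \<open>x\<^sub>i\<close> is \<open>v\<close> or \<open>w\<close>, and adding up
  \<open>K - 1\<close> of these produces every base-\<open>K\<close> digit: for each \<open>n\<close> the sums contain an arithmetic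
  progression of length \<open>K\<^sup>n\<close>, with fixed difference \<open>D\<close> and first term \<open>O(K\<^sup>n)\<close>. The element \<open>1\<close>
  fills in the residues modulo \<open>D\<close>, and a bounded number of copies of these progressions covers
  all of the natural numbers.
\<close>

section \<open>Sums of boundedly many elements\<close>

definition sum_of_at_most :: "'a::comm_monoid_add set \<Rightarrow> nat \<Rightarrow> 'a \<Rightarrow> bool" where
  "sum_of_at_most S j x \<longleftrightarrow> (\<exists>xs. set xs \<subseteq> S \<and> length xs \<le> j \<and> sum_list xs = x)"

lemma additive_basis_iff: "additive_basis S \<longleftrightarrow> (\<exists>j. \<forall>n. sum_of_at_most S j n)"
  by (simp add: additive_basis_def sum_of_at_most_def)

lemma sum_of_at_most_mono: "sum_of_at_most S i x \<Longrightarrow> i \<le> j \<Longrightarrow> sum_of_at_most S j x"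
  unfolding sum_of_at_most_def using order_trans by blast

lemma sum_of_at_most_add:
  assumes "sum_of_at_most S i x" and "sum_of_at_most S j y"
  shows "sum_of_at_most S (i + j) (x + y)"
proof -
  obtain xs ys where "set xs \<subseteq> S" "length xs \<le> i" "sum_list xs = x"
    "set ys \<subseteq> S" "length ys \<le> j" "sum_list ys = y"
    using assms unfolding sum_of_at_most_def by blast
  then have "set (xs @ ys) \<subseteq> S \<and> length (xs @ ys) \<le> i + j \<and> sum_list (xs @ ys) = x + y"
    by simp
  then show ?thesis unfolding sum_of_at_most_def by blast
qed

lemma sum_of_at_most_sum:
  assumes "\<And>i. i < m \<Longrightarrow> f i \<in> S"
  shows "sum_of_at_most S m (\<Sum>i<m. f i)"
proof -
  have "sum_list (map f [0..<m]) = (\<Sum>i<m. f i)"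
    by (simp add: interv_sum_list_conv_sum_set_nat atLeast0LessThan)
  then show ?thesis
    using assms unfolding sum_of_at_most_def by (intro exI[of _ "map f [0..<m]"]) auto
qed

lemma sum_of_at_most_ones:
  fixes x :: nat
  assumes "1 \<in> S" and "x \<le> j"
  shows "sum_of_at_most S j x"
  using sum_of_at_most_sum[of x "\<lambda>_. 1" S] assms by (auto intro: sum_of_at_most_mono)

text \<open>The summands are natural numbers, so a nonzero summand of a sum equal to 1 must be 1
  itself. This gives the necessity of \<open>1 \<in> S\<close>.\<close>

lemma one_mem_if_sum_of_at_most_one:
  fixes S :: "nat set"
  assumes "sum_of_at_most S j 1"
  shows "1 \<in> S"
proof -
  obtain xs where xs: "set xs \<subseteq> S" "sum_list xs = 1"
    using assms unfolding sum_of_at_most_def by blast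
  then obtain y where y: "y \<in> set xs" "y \<noteq> 0"
    by (metis sum_list_eq_0_iff zero_neq_one)
  then have "y \<le> 1" using xs(2) member_le_sum_list[OF y(1)] by simp
  with y xs(1) show ?thesis by (metis le_antisym less_one not_less subsetD)
qed

text \<open>Adding \<open>r\<close> copies of a progression makes it \<open>r\<close> times as long
  without changing its difference. The choice is greedy: one copy absorbs \<open>min t N\<close>
  steps, and the rest goes to the other copies by induction.\<close>

lemma sum_of_at_most_progression:
  fixes c D N :: nat
  assumes "\<And>t. t \<le> N \<Longrightarrow> sum_of_at_most S m (c + D * t)" and "t \<le> r * N"
  shows "sum_of_at_most S (r * m) (r * c + D * t)"
  using assms(2)
proof (induction r arbitrary: t)
  case 0
  then show ?case by (auto simp: sum_of_at_most_def)
next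
  case (Suc r)
  define s where "s = min t N"
  have "sum_of_at_most S (r * m) (r * c + D * (t - s))"
    using Suc.prems by (intro Suc.IH) (auto simp: s_def min_def)
  moreover have "sum_of_at_most S m (c + D * s)"
    by (rule assms(1)) (simp add: s_def)
  ultimately have "sum_of_at_most S (r * m + m) (r * c + D * (t - s) + (c + D * s))"
    by (rule sum_of_at_most_add)
  moreover have "D * (t - s) + D * s = D * t"
    by (simp add: s_def flip: add_mult_distrib2)
  then have "r * c + D * (t - s) + (c + D * s) = Suc r * c + D * t"
    by simp
  ultimately show ?case by (metis add.commute mult_Suc)
qed

text \<open>Dividing \<open>x - r * c\<close> by \<open>D\<close>, the quotient selects a term of
  the \<open>r\<close>-fold progression and the remainder is a sum of fewer than \<open>D\<close>
  ones.\<close>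

lemma sum_of_at_most_interval:
  fixes c D N :: nat
  assumes ap: "\<And>t. t \<le> N \<Longrightarrow> sum_of_at_most S m (c + D * t)" and "1 \<in> S" and "D > 0"
    and "r * c \<le> x" and "x \<le> r * c + D * (r * N)"
  shows "sum_of_at_most S (r * m + D) x"
proof -
  define s where "s = x - r * c"
  have "s \<le> D * (r * N)" using assms(5) by (simp add: s_def)
  then have "s div D \<le> r * N"
    using \<open>D > 0\<close> by (metis div_le_mono nonzero_mult_div_cancel_left not_gr_zero)
  then have "sum_of_at_most S (r * m) (r * c + D * (s div D))"
    using sum_of_at_most_progression[OF ap] by blast
  moreover have "sum_of_at_most S D (s mod D)"
    using \<open>1 \<in> S\<close> \<open>D > 0\<close> by (intro sum_of_at_most_ones) (auto intro: less_imp_le)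
  ultimately have "sum_of_at_most S (r * m + D) (r * c + D * (s div D) + s mod D)"
    by (rule sum_of_at_most_add)
  also have "r * c + D * (s div D) + s mod D = x"
    using assms(4) by (simp add: s_def add.assoc)
  finally show ?thesis .
qed

text \<open>Neither \<open>D\<close> nor \<open>m\<close> depends on \<open>n\<close>, so the scale
  \<open>K ^ n\<close> can be matched to the size of \<open>x\<close>. As \<open>c n\<close> is at
  most a constant times \<open>K ^ n\<close>, a number of copies bounded independently of
  \<open>x\<close> suffices.\<close>

lemma additive_basis_if_progressions:
  fixes c :: "nat \<Rightarrow> nat"
  assumes "K \<ge> 2" and "1 \<in> S" and "D > 0"
    and ap: "\<And>n t. t < K ^ n \<Longrightarrow> sum_of_at_most S m (c n + D * t)"
    and c: "\<And>n. c n \<le> A * K ^ n"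
  shows "additive_basis S"
proof -
  \<comment> \<open>\<open>E\<close> is large enough that \<open>E * N \<le> x\<close> forces
    \<open>x div c n\<close> to be at least \<open>2 * (A + 1)\<close>; using \<open>A + 1\<close>
    keeps it positive. \<open>R\<close> is large enough that \<open>R * (N - 1)\<close> alone
    exceeds every \<open>x\<close> of the scale chosen below.\<close>
  define E where "E = 2 * (A + 1) * (A + 1)"
  define R where "R = 2 * E * K"
  have "E > 0" by (simp add: E_def)
  have "sum_of_at_most S (R * m + D + E * K) x" for x
  proof (cases "x < E * K")
    case True
    then show ?thesis
      using sum_of_at_most_ones[OF \<open>1 \<in> S\<close>] by simp
  next
    case False
    then have xE: "K \<le> x div E"
      using \<open>E > 0\<close> by (simp add: less_eq_div_iff_mult_less_eq mult.commute)
    then have "1 \<le> x div E" using \<open>K \<ge> 2\<close> by linarith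
    from ex_power_ivl1[OF \<open>K \<ge> 2\<close> this]
    obtain n where n: "K ^ n \<le> x div E" "x div E < K ^ (n + 1)" by auto
    \<comment> \<open>Excluding \<open>n = 0\<close> gives \<open>N \<ge> 2\<close>, so
      \<open>N - 1\<close>, the last index of the progression, is at least half of
      \<open>N\<close>.\<close>
    have "n \<noteq> 0" using n(2) xE by (intro notI) simp
    define N where "N = K ^ n"
    have "N \<ge> 2"
      using \<open>n \<noteq> 0\<close> \<open>K \<ge> 2\<close> by (metis N_def le_trans bot_nat_0.not_eq_extremum self_le_power
          one_le_numeral)
    have lower: "E * N \<le> x"
      using n(1) \<open>E > 0\<close> by (simp add: N_def less_eq_div_iff_mult_less_eq mult.commute)
    have upper: "x < E * K * N"
      using n(2) \<open>E > 0\<close> by (simp add: N_def div_less_iff_less_mult mult_ac)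
    have cN: "c n \<le> (A + 1) * N" using c[of n] by (simp add: N_def)
    have ap': "sum_of_at_most S m (c n + D * t)" if "t \<le> N - 1" for t
      using that \<open>N \<ge> 2\<close> by (intro ap) (simp add: N_def)
    have half: "N \<le> 2 * (N - 1)" using \<open>N \<ge> 2\<close> by simp
    \<comment> \<open>If \<open>R\<close> copies of the first term do not overshoot
      \<open>x\<close>, then \<open>R\<close> copies reach far enough. Otherwise the quotient of
      \<open>x\<close> by \<open>c n\<close> is at most \<open>R\<close>, and the remainder, being
      below \<open>c n\<close>, lies within reach \<open>r * (N - 1)\<close>.\<close>
    obtain r where r: "r \<le> R" "r * c n \<le> x" "x \<le> r * c n + r * (N - 1)"
    proof (cases "R * c n \<le> x")
      case True
      have "x \<le> E * K * (2 * (N - 1))"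
        using upper half by (meson le_trans less_imp_le mult_le_mono2)
      also have "\<dots> = R * (N - 1)" by (simp add: R_def)
      finally show ?thesis using True that[of R] by simp
    next
      case False
      then have pos: "c n > 0" by (intro gr0I) simp
      define r where "r = x div c n"
      have "2 * (A + 1) * c n \<le> 2 * (A + 1) * ((A + 1) * N)"
        using cN by (rule mult_le_mono2)
      also have "\<dots> = E * N" by (simp only: E_def mult_ac)
      also have "\<dots> \<le> x" by (rule lower)
      finally have rA: "2 * (A + 1) \<le> r"
        using pos by (simp add: r_def less_eq_div_iff_mult_less_eq)
      have "c n \<le> (A + 1) * (2 * (N - 1))"
        using cN half by (meson le_trans mult_le_mono2)
      also have "\<dots> = 2 * (A + 1) * (N - 1)" by simp
      also have "\<dots> \<le> r * (N - 1)" using rA by (rule mult_le_mono1)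
      finally have "c n \<le> r * (N - 1)" .
      moreover have "x = r * c n + x mod c n" "x mod c n < c n" using pos by (simp_all add: r_def)
      ultimately have "x \<le> r * c n + r * (N - 1)" by linarith
      moreover have "r \<le> R"
        using False pos unfolding r_def
        by (metis div_le_mono less_imp_le nonzero_mult_div_cancel_right not_gr_zero not_le)
      ultimately show ?thesis using that[of r] by (simp add: r_def)
    qed
    have "r * (N - 1) \<le> D * (r * (N - 1))" using \<open>D > 0\<close> by simp
    then have "x \<le> r * c n + D * (r * (N - 1))" using r(3) by linarith
    from sum_of_at_most_interval[OF ap' \<open>1 \<in> S\<close> \<open>D > 0\<close> r(2) this]
    have "sum_of_at_most S (r * m + D) x" .
    moreover have "r * m \<le> R * m" using r(1) by simp
    ultimately show ?thesis by (elim sum_of_at_most_mono) linarith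
  qed
  then show ?thesis unfolding additive_basis_iff by blast
qed

section \<open>Two loops of equal length\<close>

text \<open>Think of \<open>T n\<close> as numbers with \<open>n\<close> digits in base
  \<open>K\<close>, each digit \<open>a\<close> or \<open>a + d\<close>. At each position, any
  number from 0 to \<open>K - 1\<close> of the \<open>K - 1\<close> summands may carry the larger
  digit; that number is the digit of \<open>t\<close> there.\<close>

lemma sum_of_restricted_digits:
  fixes T :: "nat \<Rightarrow> nat set"
  assumes "K > 0" and "0 \<in> T 0"
    and low: "\<And>n x. x \<in> T n \<Longrightarrow> K * x + a \<in> T (Suc n)"
    and high: "\<And>n x. x \<in> T n \<Longrightarrow> K * x + (a + d) \<in> T (Suc n)"
    and "t < K ^ n"
  shows "\<exists>f. (\<forall>i<K-1. f i \<in> T n) \<and>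
             (\<Sum>i<K-1. f i) = (K - 1) * (\<Sum>i<n. a * K ^ i) + d * t"
  using \<open>t < K ^ n\<close>
proof (induction n arbitrary: t)
  case 0
  then show ?case using \<open>0 \<in> T 0\<close> by (intro exI[of _ "\<lambda>_. 0"]) simp
next
  case (Suc n)
  have "t div K < K ^ n"
    using Suc.prems \<open>K > 0\<close> by (simp add: div_less_iff_less_mult mult.commute)
  then obtain f where f: "\<forall>i<K-1. f i \<in> T n"
    "(\<Sum>i<K-1. f i) = (K - 1) * (\<Sum>i<n. a * K ^ i) + d * (t div K)"
    using Suc.IH by blast
  \<comment> \<open>The last digit of \<open>t\<close> tells how many summands receive
    \<open>a + d\<close>; the leading digits \<open>t div K\<close> are handled by
    induction.\<close>
  define g where "g i = K * f i + (if i < t mod K then a + d else a)" for i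
  have "t mod K \<le> K - 1" using \<open>K > 0\<close> by (metis Suc_pred' less_Suc_eq_le mod_less_divisor)
  then have "(\<Sum>i<K-1. if i < t mod K then d else 0) = (\<Sum>i<t mod K. d)"
    by (intro sum.mono_neutral_cong_right) auto
  then have digit: "(\<Sum>i<K-1. if i < t mod K then d else 0) = d * (t mod K)"
    by (simp only: sum_constant card_lessThan of_nat_id mult.commute)
  have "(\<Sum>i<K-1. g i) = (\<Sum>i<K-1. K * f i + a + (if i < t mod K then d else 0))"
    by (intro sum.cong) (auto simp: g_def)
  also have "\<dots> = K * (\<Sum>i<K-1. f i) + (K - 1) * a + d * (t mod K)"
    by (simp only: sum.distrib digit sum_constant card_lessThan of_nat_id flip: sum_distrib_left)
  also have "\<dots> = (K - 1) * (a + K * (\<Sum>i<n. a * K ^ i)) + d * (K * (t div K) + t mod K)"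
    unfolding f(2) by (simp only: add_mult_distrib2 mult_ac add_ac)
  also have "a + K * (\<Sum>i<n. a * K ^ i) = (\<Sum>i<Suc n. a * K ^ i)"
    by (simp add: sum.lessThan_Suc_shift sum_distrib_left mult_ac del: sum.lessThan_Suc)
  also have "K * (t div K) + t mod K = t" by simp
  finally have "(\<Sum>i<K-1. g i) = (K - 1) * (\<Sum>i<Suc n. a * K ^ i) + d * t" .
  moreover have "\<forall>i<K-1. g i \<in> T (Suc n)"
    using f(1) low high by (simp add: g_def)
  ultimately show ?case by blast
qed

section \<open>Values of words in base \<open>k\<close>\<close>

definition word_val :: "nat \<Rightarrow> nat list \<Rightarrow> nat" where
  "word_val k w = horner_sum of_nat k (rev w)"

lemma word_val_simps [simp]:
  "word_val k [] = 0" "word_val k (w @ [a]) = k * word_val k w + a"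
  by (simp_all add: word_val_def)

lemma word_val_append: "word_val k (u @ v) = word_val k u * k ^ length v + word_val k v"
  by (induction v rule: rev_induct) (simp_all add: algebra_simps flip: append_assoc)

lemma word_val_less: "w \<in> lists {..<k} \<Longrightarrow> word_val k w < k ^ length w"
proof (induction w rule: rev_induct)
  case (snoc a w)
  then have "word_val k w + 1 \<le> k ^ length w" "a < k" by auto
  then have "k * (word_val k w + 1) \<le> k * k ^ length w" by (intro mult_le_mono2)
  with \<open>a < k\<close> show ?case by simp
qed simp

text \<open>The last digits agree modulo \<open>k\<close>, and then the quotients agree. Leading
  zeros are allowed in these words, which is why the lengths are required to agree.\<close>

lemma word_val_inj:
  assumes "v \<in> lists {..<k}" "w \<in> lists {..<k}" "length v = length w"
    and "word_val k v = word_val k w"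
  shows "v = w"
  using assms(3,1,2,4)
proof (induction v w rule: rev_induct2)
  case (4 a v b w)
  then have "a < k" "b < k" "k * word_val k v + a = k * word_val k w + b" by auto
  then have "a = b \<and> word_val k v = word_val k w"
    by (metis add.commute div_less div_mult_self2 less_nat_zero_code
        mod_less mod_mult_self2 add_0)
  with 4 show ?case by auto
qed auto

text \<open>Blocks \<open>v\<close> and \<open>w\<close> act as two digits in base \<open>K\<close>,
  framed by \<open>u\<close> and \<open>z\<close>. Adding \<open>K - 1\<close> such numbers gives
  progressions whose difference is the same for every \<open>n\<close>.\<close>

lemma additive_basis_if_two_loops:
  fixes \<delta> :: "'q \<Rightarrow> nat \<Rightarrow> 'q"
  assumes "k \<ge> 2" and "1 \<in> S"
    and acc: "\<And>w. w \<in> lists {..<k} \<Longrightarrow> foldl \<delta> q0 w \<in> F \<Longrightarrow> word_val k w \<in> S"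
    and words: "u \<in> lists {..<k}" "z \<in> lists {..<k}" "v \<in> lists {..<k}" "w \<in> lists {..<k}"
    and q: "foldl \<delta> q0 u = q" "foldl \<delta> q z \<in> F"
    and loops: "foldl \<delta> q v = q" "foldl \<delta> q w = q"
    and "length v = length w" and less: "word_val k v < word_val k w"
  shows "additive_basis S"
proof -
  define K where "K = k ^ length v"
  define T where "T n = word_val k ` {y \<in> lists {..<k}. foldl \<delta> q y = q \<and> k ^ length y = K ^ n}" for n
  define a where "a = word_val k v"
  define d where "d = word_val k w - a"
  define h where "h = k ^ length z"
  \<comment> \<open>\<open>g n\<close> is the contribution of the frame \<open>u\<close>,
    \<open>z\<close>; the suffix \<open>z\<close> shifts the middle part by the factor
    \<open>h\<close>.\<close>
  define g where "g n = word_val k u * K ^ n * h + word_val k z" for n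
  define b where "b n = (\<Sum>i<n. a * K ^ i)" for n
  have "v \<noteq> []" using less \<open>length v = length w\<close> by auto
  then have "K \<ge> 2"
    using \<open>k \<ge> 2\<close> by (metis K_def le_trans length_greater_0_conv one_le_numeral self_le_power)
  have step: "K * x + word_val k y \<in> T (Suc n)"
    if "x \<in> T n" "y \<in> lists {..<k}" "foldl \<delta> q y = q" "length y = length v" for x y n
  proof -
    obtain y' where "y' \<in> lists {..<k}" "foldl \<delta> q y' = q" "k ^ length y' = K ^ n"
      "x = word_val k y'" using \<open>x \<in> T n\<close> by (auto simp: T_def)
    with that show ?thesis unfolding T_def
      by (intro image_eqI[of _ _ "y' @ y"]) (auto simp: word_val_append K_def power_add)
  qed
  have inS: "g n + h * x \<in> S" if x: "x \<in> T n" for x n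
  proof -
    obtain y where y: "y \<in> lists {..<k}" "foldl \<delta> q y = q" "k ^ length y = K ^ n"
      "x = word_val k y" using x by (auto simp: T_def)
    then have "word_val k (u @ y @ z) \<in> S"
      using words q by (intro acc) auto
    also have "word_val k (u @ y @ z) = g n + h * x"
      using y by (simp add: word_val_append g_def h_def power_add algebra_simps)
    finally show ?thesis .
  qed
  have ap: "sum_of_at_most S (K - 1) ((K - 1) * (g n + h * b n) + h * d * t)"
    if "t < K ^ n" for n t
  proof -
    have "\<exists>f. (\<forall>i<K-1. f i \<in> T n) \<and> (\<Sum>i<K-1. f i) = (K - 1) * b n + d * t"
      unfolding b_def
    proof (rule sum_of_restricted_digits[OF _ _ _ _ that])
      show "0 \<in> T 0" unfolding T_def by (intro image_eqI[of _ _ "[]"]) auto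
      show "K * x + a \<in> T (Suc n)" if "x \<in> T n" for n x
        using step[OF that] words loops by (simp add: a_def)
      show "K * x + (a + d) \<in> T (Suc n)" if "x \<in> T n" for n x
        using step[OF that, of w] words loops less \<open>length v = length w\<close> by (simp add: a_def d_def)
    qed (use \<open>K \<ge> 2\<close> in simp)
    then obtain f where f: "\<forall>i<K-1. f i \<in> T n" "(\<Sum>i<K-1. f i) = (K - 1) * b n + d * t"
      by blast
    then have "sum_of_at_most S (K - 1) (\<Sum>i<K-1. g n + h * f i)"
      by (intro sum_of_at_most_sum inS) simp
    also have "(\<Sum>i<K-1. g n + h * f i) = (K - 1) * g n + h * ((K - 1) * b n + d * t)"
      by (simp add: sum.distrib f(2)[simplified] flip: sum_distrib_left)
    finally show ?thesis by (simp add: algebra_simps)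
  qed
  have "a < K" using word_val_less words by (simp add: a_def K_def)
  \<comment> \<open>\<open>b n\<close> is the value of \<open>v\<close> repeated \<open>n\<close>
    times, and \<open>a + 1 \<le> K\<close> carries the bound through the induction.\<close>
  have b_less: "b n < K ^ n" for n
  proof (induction n)
    case 0
    show ?case by (simp add: b_def)
  next
    case (Suc n)
    have "(a + 1) * K ^ n \<le> K * K ^ n" using \<open>a < K\<close> by (intro mult_le_mono1) simp
    with Suc show ?case by (simp add: b_def)
  qed
  have bound: "(K - 1) * (g n + h * b n) \<le> (K - 1) * (word_val k u * h + word_val k z + h) * K ^ n" for n
  proof -
    have "word_val k z \<le> word_val k z * K ^ n" using \<open>K \<ge> 2\<close> by simp
    moreover have "h * b n \<le> h * K ^ n" using b_less[of n] by simp
    ultimately have "word_val k u * K ^ n * h + word_val k z + h * b n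
        \<le> word_val k u * K ^ n * h + word_val k z * K ^ n + h * K ^ n" by linarith
    then have "g n + h * b n \<le> (word_val k u * h + word_val k z + h) * K ^ n"
      by (simp only: g_def add_mult_distrib add_mult_distrib2 mult_ac)
    then show ?thesis by (metis mult.assoc mult_le_mono2)
  qed
  have "h * d > 0" using \<open>k \<ge> 2\<close> less by (simp add: h_def d_def a_def)
  from additive_basis_if_progressions[OF \<open>K \<ge> 2\<close> \<open>1 \<in> S\<close> this ap bound] show ?thesis .
qed

section \<open>Counting words without two loops of equal length\<close>

text \<open>Both the starting state and the last state count as visited, so deleting a state from
  \<open>X\<close> forces a run to avoid it altogether.\<close>

primrec run_in :: "('q \<Rightarrow> 'a \<Rightarrow> 'q) \<Rightarrow> 'q set \<Rightarrow> 'q \<Rightarrow> 'a list \<Rightarrow> bool" where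
  "run_in \<delta> X q [] \<longleftrightarrow> q \<in> X"
| "run_in \<delta> X q (a # w) \<longleftrightarrow> q \<in> X \<and> run_in \<delta> X (\<delta> q a) w"

lemma run_in_iff: "run_in \<delta> X q w \<longleftrightarrow> (\<forall>u v. w = u @ v \<longrightarrow> foldl \<delta> q u \<in> X)"
proof (induction w arbitrary: q)
  case (Cons a w)
  show ?case unfolding run_in.simps Cons.IH
  proof (intro iffI conjI allI impI)
    fix u v assume *: "q \<in> X \<and> (\<forall>u v. w = u @ v \<longrightarrow> foldl \<delta> (\<delta> q a) u \<in> X)" "a # w = u @ v"
    then show "foldl \<delta> q u \<in> X" by (cases u) auto
  next
    assume *: "\<forall>u v. a # w = u @ v \<longrightarrow> foldl \<delta> q u \<in> X"
    show "q \<in> X" using *[rule_format, of "[]"] by simp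
    show "foldl \<delta> (\<delta> q a) u \<in> X" if "w = u @ v" for u v
      using *[rule_format, of "a # u" v] that by simp
  qed
qed simp

text \<open>In the induction, a visit to \<open>q\<close> in the tail takes precedence over one at
  the current state. A run ending in \<open>q\<close> is a case of its own because no letter follows
  that last visit.\<close>

lemma run_in_split_last_visit:
  assumes "run_in \<delta> X p w"
  shows "run_in \<delta> (X - {q}) p w \<or> (foldl \<delta> p w = q) \<or>
    (\<exists>l a w'. w = l @ a # w' \<and> foldl \<delta> p l = q \<and> run_in \<delta> (X - {q}) (\<delta> q a) w')"
  using assms
proof (induction w arbitrary: p)
  case (Cons a w)
  then have "run_in \<delta> X (\<delta> p a) w" by simp
  from Cons.IH[OF this] consider "run_in \<delta> (X - {q}) (\<delta> p a) w" | "foldl \<delta> (\<delta> p a) w = q"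
    | l b w' where "w = l @ b # w'" "foldl \<delta> (\<delta> p a) l = q" "run_in \<delta> (X - {q}) (\<delta> q b) w'"
    by blast
  then show ?case
  proof cases
    case 1
    show ?thesis
    proof (cases "p = q")
      case True
      then have "a # w = [] @ a # w \<and> foldl \<delta> p [] = q \<and> run_in \<delta> (X - {q}) (\<delta> q a) w"
        using 1 by simp
      then show ?thesis by blast
    next
      case False
      then show ?thesis using 1 Cons.prems by simp
    qed
  next
    case 3
    then have "a # w = (a # l) @ b # w' \<and> foldl \<delta> p (a # l) = q \<and> run_in \<delta> (X - {q}) (\<delta> q b) w'"
      by simp
    then show ?thesis by blast
  qed simp
qed simp

definition runs :: "'a set \<Rightarrow> ('q \<Rightarrow> 'a \<Rightarrow> 'q) \<Rightarrow> 'q set \<Rightarrow> 'q \<Rightarrow> nat \<Rightarrow> 'a list set" where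
  "runs \<Sigma> \<delta> X q n = {w \<in> lists \<Sigma>. length w = n \<and> run_in \<delta> X q w}"

text \<open>Induction on the number of states. Up to its last visit to \<open>q\<close> a run is a
  loop, determined by its length; afterwards come one letter and a run with one state fewer. Each
  state thus costs one factor \<open>card \<Sigma> * n + 1\<close>.\<close>

lemma card_runs_le:
  assumes "finite \<Sigma>" and "finite X"
    and "\<And>q v w. q \<in> X \<Longrightarrow> v \<in> lists \<Sigma> \<Longrightarrow> w \<in> lists \<Sigma> \<Longrightarrow> length v = length w \<Longrightarrow>
           foldl \<delta> q v = q \<Longrightarrow> foldl \<delta> q w = q \<Longrightarrow> v = w"
  shows "card (runs \<Sigma> \<delta> X q n) \<le> (card \<Sigma> * n + 1) ^ card X"
  using assms(2,3)
proof (induction "card X" arbitrary: X q n)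
  case 0
  then have "X = {}" by simp
  then have "runs \<Sigma> \<delta> X q n = {}"
    by (auto simp: runs_def run_in_iff)
  then show ?case by simp
next
  case (Suc m)
  define s where "s = card \<Sigma>"
  have fin: "finite (runs \<Sigma> \<delta> Y p i)" for Y p i
    by (rule finite_subset[OF _ finite_lists_length_eq[OF \<open>finite \<Sigma>\<close>, of i]]) (auto simp: runs_def)
  show ?case
  proof (cases "q \<in> X")
    case False
    then have "\<not> run_in \<delta> X q w" for w by (cases w) auto
    then show ?thesis by (simp add: runs_def)
  next
    case True
    define loops where "loops i = {w \<in> lists \<Sigma>. length w = i \<and> foldl \<delta> q w = q}" for i
    have loops: "finite (loops i)" "card (loops i) \<le> 1" for i
    proof -
      show "finite (loops i)"
        by (rule finite_subset[OF _ finite_lists_length_eq[OF \<open>finite \<Sigma>\<close>, of i]])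
          (auto simp: loops_def)
      have "v = w" if "v \<in> loops i" "w \<in> loops i" for v w
        using Suc.prems(2)[OF True, of v w] that by (simp add: loops_def)
      with \<open>finite (loops i)\<close> show "card (loops i) \<le> 1"
        by (simp add: card_le_Suc0_iff_eq)
    qed
    define Y where "Y = X - {q}"
    have Y: "m = card Y" "finite Y" using Suc.hyps(2) Suc.prems(1) True by (auto simp: Y_def)
    have unique: "v = w" if "p \<in> Y" "v \<in> lists \<Sigma>" "w \<in> lists \<Sigma>" "length v = length w"
      "foldl \<delta> p v = p" "foldl \<delta> p w = p" for p v w
      using Suc.prems(2)[of p v w] that by (simp add: Y_def)
    \<comment> \<open>The words that visit \<open>q\<close> for the last time after \<open>i\<close>
      letters and leave it by the letter \<open>a\<close>.\<close>
    define cont where "cont i a = (\<lambda>(l, w). l @ a # w) ` (loops i \<times> runs \<Sigma> \<delta> Y (\<delta> q a) (n - i - 1))" for i a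
    have "card (cont i a) \<le> (s * n + 1) ^ m" for i a
    proof -
      have "card (cont i a) \<le> card (loops i \<times> runs \<Sigma> \<delta> Y (\<delta> q a) (n - i - 1))"
        unfolding cont_def by (intro card_image_le finite_cartesian_product loops fin)
      also have "\<dots> = card (loops i) * card (runs \<Sigma> \<delta> Y (\<delta> q a) (n - i - 1))"
        by (rule card_cartesian_product)
      also have "\<dots> \<le> 1 * (s * (n - i - 1) + 1) ^ card Y"
        unfolding s_def by (intro mult_le_mono loops Suc.hyps(1)[OF Y] unique)
      also have "\<dots> \<le> (s * n + 1) ^ m"
        unfolding Y(1) by (simp add: power_mono)
      finally show ?thesis .
    qed
    then have "card (\<Union>a\<in>\<Sigma>. cont i a) \<le> s * (s * n + 1) ^ m" for i
      using card_UN_le[OF \<open>finite \<Sigma>\<close>, of "cont i"]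
        sum_bounded_above[of \<Sigma> "\<lambda>a. card (cont i a)" "(s * n + 1) ^ m"]
      by (force simp: s_def intro: order_trans)
    then have conts: "card (\<Union>i<n. \<Union>a\<in>\<Sigma>. cont i a) \<le> n * (s * (s * n + 1) ^ m)"
      using card_UN_le[of "{..<n}" "\<lambda>i. \<Union>a\<in>\<Sigma>. cont i a"]
        sum_bounded_above[of "{..<n}" "\<lambda>i. card (\<Union>a\<in>\<Sigma>. cont i a)" "s * (s * n + 1) ^ m"]
      by (force intro: order_trans)
    have sub: "runs \<Sigma> \<delta> X q n \<subseteq> loops n \<union> (\<Union>i<n. \<Union>a\<in>\<Sigma>. cont i a)"
    proof
      fix w assume w: "w \<in> runs \<Sigma> \<delta> X q n"
      then have "run_in \<delta> X q w" by (simp add: runs_def)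
      \<comment> \<open>The run starts in \<open>q\<close>, so it cannot avoid \<open>q\<close>, and
        one alternative of the splitting drops out.\<close>
      moreover have "\<not> run_in \<delta> (X - {q}) q w" by (cases w) auto
      ultimately consider "foldl \<delta> q w = q"
        | l a w' where "w = l @ a # w'" "foldl \<delta> q l = q" "run_in \<delta> Y (\<delta> q a) w'"
        using run_in_split_last_visit[of \<delta> X q w q] unfolding Y_def by blast
      then show "w \<in> loops n \<union> (\<Union>i<n. \<Union>a\<in>\<Sigma>. cont i a)"
      proof cases
        case 1
        then show ?thesis using w by (simp add: loops_def runs_def)
      next
        case 2
        then have "length l < n" "a \<in> \<Sigma>" "w \<in> cont (length l) a"
          using w by (auto simp: runs_def loops_def cont_def image_iff)
        then show ?thesis by blast
      qed
    qed
    have "finite (\<Union>i<n. \<Union>a\<in>\<Sigma>. cont i a)"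
      using \<open>finite \<Sigma>\<close> fin loops(1) by (auto simp: cont_def)
    with sub have "card (runs \<Sigma> \<delta> X q n) \<le> card (loops n \<union> (\<Union>i<n. \<Union>a\<in>\<Sigma>. cont i a))"
      using loops(1) by (intro card_mono) auto
    also have "\<dots> \<le> card (loops n) + card (\<Union>i<n. \<Union>a\<in>\<Sigma>. cont i a)" by (rule card_Un_le)
    also have "\<dots> \<le> 1 + n * (s * (s * n + 1) ^ m)" by (intro add_mono loops conts)
    \<comment> \<open>Enlarging 1 to the common power lets the sum factor as
      \<open>(s * n + 1) * (s * n + 1) ^ m\<close>.\<close>
    also have "\<dots> \<le> (s * n + 1) ^ m + n * (s * (s * n + 1) ^ m)"
      by (intro add_mono) auto
    also have "\<dots> = (s * n + 1) ^ card X"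
      by (simp add: Suc.hyps(2)[symmetric] algebra_simps)
    finally show ?thesis by (simp add: s_def)
  qed
qed

lemma card_words_of_length_le:
  fixes L :: "'a list set"
  assumes "\<And>l. l \<le> n \<Longrightarrow> card {w \<in> L. length w = l} \<le> B"
  shows "card {w \<in> L. length w \<le> n} \<le> (n + 1) * B"
proof -
  have "{w \<in> L. length w \<le> n} = (\<Union>l\<le>n. {w \<in> L. length w = l})" by auto
  also have "card \<dots> \<le> (\<Sum>l\<le>n. card {w \<in> L. length w = l})" by (rule card_UN_le) simp
  also have "\<dots> \<le> (\<Sum>l\<le>n. B)" using assms by (intro sum_mono) simp
  finally show ?thesis by simp
qed

section \<open>Sparseness\<close>

text \<open>The nonzero leading digit contributes at least \<open>k ^ (length w - 1)\<close>. The
  weaker base 2 makes later length estimates independent of \<open>k\<close>.\<close>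

lemma canonical_word_length:
  assumes "canonical_word k n w" and "k \<ge> 2" and "w \<noteq> []"
  shows "2 ^ (length w - 1) \<le> n"
proof -
  obtain a v where w: "w = a # v" using \<open>w \<noteq> []\<close> by (cases w) auto
  then have "a > 0" using assms(1) by (simp add: canonical_word_def)
  have "n = word_val k ([a] @ v)"
    using assms(1) w by (simp add: canonical_word_def word_val_def)
  also have "\<dots> = a * k ^ length v + word_val k v"
    unfolding word_val_append by (simp add: word_val_def)
  finally have "k ^ length v \<le> n" using \<open>a > 0\<close> by (cases a) auto
  moreover have "2 ^ length v \<le> k ^ length v" using \<open>k \<ge> 2\<close> by (rule power_mono) simp
  ultimately show ?thesis using w by simp
qed

text \<open>Expansions of numbers up to \<open>x\<close> have length \<open>O(ln x)\<close>, so
  polynomially many words per length give a polynomial in \<open>ln x\<close>.\<close>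

lemma sparse_if_polynomial_growth:
  assumes "k \<ge> 2"
    and "\<And>n. card {w \<in> canonical_expansion k ` S. length w = n} \<le> (c * n + 1) ^ m"
  shows "sparse S"
proof -
  have can: "canonical_word k n (canonical_expansion k n)" for n
    using \<open>k \<ge> 2\<close> by (rule canonical_word_canonical_expansion)
  have inj: "inj_on (canonical_expansion k) A" for A
    using can unfolding canonical_word_def by (metis inj_onI)
  \<comment> \<open>From 3 on, \<open>ln x \<ge> 1\<close>, so additive constants can be absorbed
    into multiples of \<open>ln x\<close>.\<close>
  have bound: "real (counting S x) \<le> (4 * (real c + 1)) ^ (m + 1) * ln x ^ (m + 1)" if x: "x \<ge> 3" for x
  proof -
    have "exp 1 \<le> (3::real)" by (rule exp_le)
    then have ln1: "ln x \<ge> 1" using x by (simp add: ln_ge_iff)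
    define n where "n = nat \<lfloor>1 + ln x / ln 2\<rfloor>"
    have len: "length (canonical_expansion k a) \<le> n" if "real a \<le> x" for a
    proof (cases "canonical_expansion k a = []")
      case False
      define l where "l = length (canonical_expansion k a) - 1"
      have "2 ^ l \<le> a" unfolding l_def using can \<open>k \<ge> 2\<close> False by (rule canonical_word_length)
      then have "(2::real) ^ l \<le> x" using that by (metis of_nat_le_iff of_nat_numeral of_nat_power order_trans)
      then have "ln ((2::real) ^ l) \<le> ln x" using x by (subst ln_le_cancel_iff) auto
      then have "real l * ln 2 \<le> ln x" by (simp add: ln_realpow)
      then have "real l \<le> ln x / ln 2" by (simp add: field_simps)
      moreover have "length (canonical_expansion k a) = l + 1" using False by (simp add: l_def)
      ultimately show ?thesis unfolding n_def by (intro le_nat_floor) simp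
    qed simp
    have "finite {w \<in> canonical_expansion k ` S. length w \<le> n}"
      by (rule finite_subset[OF _ finite_lists_length_le[of "{..<k}" n]])
        (use can in \<open>auto simp: canonical_word_def\<close>)
    then have "counting S x \<le> card {w \<in> canonical_expansion k ` S. length w \<le> n}"
      unfolding counting_def card_image[OF inj, symmetric]
      by (rule card_mono) (use len in auto)
    also have "\<dots> \<le> (n + 1) * (c * n + 1) ^ m"
    proof (rule card_words_of_length_le)
      fix l assume "l \<le> n"
      then have "(c * l + 1) ^ m \<le> (c * n + 1) ^ m" by (intro power_mono) auto
      with assms(2)[of l] show "card {w \<in> canonical_expansion k ` S. length w = l} \<le> (c * n + 1) ^ m"
        by linarith
    qed
    also have "\<dots> \<le> ((c + 1) * (n + 1)) * ((c + 1) * (n + 1)) ^ m"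
      by (intro mult_mono power_mono) auto
    also have "\<dots> = ((c + 1) * (n + 1)) ^ (m + 1)" by simp
    finally have "real (counting S x) \<le> real (((c + 1) * (n + 1)) ^ (m + 1))"
      by (simp only: of_nat_le_iff)
    also have "\<dots> = ((real c + 1) * (real n + 1)) ^ (m + 1)"
      by (simp only: of_nat_power of_nat_mult of_nat_add of_nat_1)
    also have "\<dots> \<le> ((real c + 1) * (4 * ln x)) ^ (m + 1)"
    proof (intro power_mono mult_left_mono)
      \<comment> \<open>With this bound, \<open>n + 1\<close> is at most
        \<open>2 + 2 * ln x\<close>, hence at most \<open>4 * ln x\<close>.\<close>
      have "ln 2 \<ge> (1/2::real)" using ln_le_minus_one[of "1/2"] by (simp add: ln_div)
      then have "ln x / ln 2 \<le> ln x / (1/2)" using ln1 by (intro divide_left_mono) auto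
      moreover have "real n \<le> 1 + ln x / ln 2" unfolding n_def using ln1 by (intro of_nat_floor) simp
      ultimately show "real n + 1 \<le> 4 * ln x" using ln1 by simp
    qed auto
    also have "\<dots> = (4 * (real c + 1)) ^ (m + 1) * ln x ^ (m + 1)"
      by (simp only: flip: power_mult_distrib) (simp only: mult_ac)
    finally show ?thesis .
  qed
  have "(\<lambda>x. real (counting S x)) \<in> O[at_top](\<lambda>x. ln x ^ (m + 1))"
  proof (rule bigoI)
    show "\<forall>\<^sub>F x in at_top. norm (real (counting S x)) \<le> (4 * (real c + 1)) ^ (m + 1) * norm (ln x ^ (m + 1))"
      using eventually_ge_at_top[of 3]
    proof eventually_elim
      case (elim x)
      then have "norm (ln x ^ (m + 1)) = ln x ^ (m + 1)" by simp
      with bound[OF elim] show ?case by simp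
    qed
  qed
  then show ?thesis unfolding sparse_def by blast
qed

section \<open>Necessity: additive bases are not sparse\<close>

lemma not_sparse_if_additive_basis:
  assumes "additive_basis S"
  shows "\<not> sparse S"
proof
  obtain j where j: "\<And>n. sum_of_at_most S j n" using assms unfolding additive_basis_iff by blast
  then have "1 \<in> S" by (blast intro: one_mem_if_sum_of_at_most_one)
  \<comment> \<open>Numbers up to \<open>n\<close> only use summands up to \<open>n\<close>, so they
    are sums of lists of length at most \<open>j\<close> over \<open>A\<close>. As \<open>A\<close>
    contains 1, each of the \<open>j + 1\<close> lengths accounts for at most
    \<open>card A ^ j\<close> lists.\<close>
  have count: "n \<le> (j + 1) * counting S (real n) ^ j" if "n \<ge> 1" for n
  proof -
    define A where "A = {m \<in> S. m \<le> n}"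
    define W where "W = {xs. set xs \<subseteq> A \<and> length xs \<le> j}"
    have A: "finite A" "card A = counting S (real n)" by (simp_all add: A_def counting_def)
    then have fW: "finite W" by (simp add: W_def finite_lists_length_le)
    have "1 \<in> A" using \<open>1 \<in> S\<close> \<open>n \<ge> 1\<close> by (simp add: A_def)
    then have pos: "card A \<ge> 1" using A(1) card_gt_0_iff[of A] by (auto simp: Suc_le_eq)
    have "{..n} \<subseteq> sum_list ` W"
    proof
      fix x assume "x \<in> {..n}"
      moreover obtain xs where xs: "set xs \<subseteq> S" "length xs \<le> j" "sum_list xs = x"
        using j[of x] unfolding sum_of_at_most_def by blast
      ultimately have "set xs \<subseteq> A"
        using member_le_sum_list[of _ xs] by (fastforce simp: A_def)
      with xs show "x \<in> sum_list ` W" by (auto simp: W_def)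
    qed
    then have "card {..n} \<le> card (sum_list ` W)" using fW by (intro card_mono) auto
    also have "\<dots> \<le> card W" using fW by (rule card_image_le)
    also have "\<dots> = (\<Sum>i\<le>j. card A ^ i)" unfolding W_def using A(1) by (rule card_lists_length_le)
    also have "\<dots> \<le> (\<Sum>i\<le>j. card A ^ j)" using pos by (intro sum_mono power_increasing) auto
    finally show ?thesis by (simp add: A(2))
  qed
  assume "sparse S"
  then obtain d where "(\<lambda>x. real (counting S x)) \<in> O[at_top](\<lambda>x. ln x ^ d)"
    unfolding sparse_def by blast
  then obtain c where "c > 0"
    and c: "\<forall>\<^sub>F x in at_top. norm (real (counting S x)) \<le> c * norm (ln x ^ d)"
    by (elim landau_o.bigE)
  define C where "C = (real j + 1) * c ^ j"
  have "C > 0" using \<open>c > 0\<close> by (simp add: C_def)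
  \<comment> \<open>Writing \<open>x\<close> as \<open>exp (ln x)\<close> reduces the comparison of
    a power of \<open>ln x\<close> with \<open>x\<close> to that of a power with the exponential.
    The threshold \<open>1 / C\<close> is what yields \<open>n < n\<close> at the end.\<close>
  have "((\<lambda>x::real. ln x ^ (d * j) / exp (ln x)) \<longlongrightarrow> 0) at_top"
    by (rule filterlim_compose[OF tendsto_power_div_exp_0 ln_at_top])
  then have "\<forall>\<^sub>F x::real in at_top. ln x ^ (d * j) / exp (ln x) < 1 / C"
    using \<open>C > 0\<close> by (intro order_tendstoD) auto
  with c eventually_ge_at_top[of 1]
  have "\<forall>\<^sub>F x::real in at_top. x \<ge> 1 \<and> ln x ^ (d * j) / exp (ln x) < 1 / C \<and>
      norm (real (counting S x)) \<le> c * norm (ln x ^ d)"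
    by eventually_elim blast
  then have "\<forall>\<^sub>F n in sequentially. real n \<ge> 1 \<and> ln (real n) ^ (d * j) / exp (ln (real n)) < 1 / C \<and>
      norm (real (counting S (real n))) \<le> c * norm (ln (real n) ^ d)"
    by (rule eventually_compose_filterlim[OF _ filterlim_real_sequentially])
  then obtain n where n: "real n \<ge> 1" "ln (real n) ^ (d * j) / exp (ln (real n)) < 1 / C"
      "norm (real (counting S (real n))) \<le> c * norm (ln (real n) ^ d)"
    by (auto simp: eventually_sequentially)
  have "ln (real n) \<ge> 0" using n(1) by simp
  then have n3: "real (counting S (real n)) \<le> c * ln (real n) ^ d" using n(3) by simp
  have "real n \<le> real ((j + 1) * counting S (real n) ^ j)"
    using count[of n] n(1) by (simp only: of_nat_le_iff)
  also have "\<dots> = (real j + 1) * real (counting S (real n)) ^ j" by (simp add: algebra_simps)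
  also have "\<dots> \<le> (real j + 1) * (c * ln (real n) ^ d) ^ j"
    using n3 by (intro mult_left_mono power_mono) auto
  also have "\<dots> = C * ln (real n) ^ (d * j)" by (simp add: C_def power_mult_distrib power_mult)
  also have "\<dots> < real n" using n(1,2) \<open>C > 0\<close> by (simp add: field_simps)
  finally show False by simp
qed

section \<open>Extracting two loops from the automaton\<close>

lemma two_loops_if_automatic_not_sparse:
  assumes "k \<ge> 2" and "automatic k S" and "\<not> sparse S"
  obtains \<delta> :: "nat \<Rightarrow> nat \<Rightarrow> nat" and q0 F q u z v w where
    "\<And>w. w \<in> lists {..<k} \<Longrightarrow> foldl \<delta> q0 w \<in> F \<Longrightarrow> word_val k w \<in> S"
    "u \<in> lists {..<k}" "z \<in> lists {..<k}" "v \<in> lists {..<k}" "w \<in> lists {..<k}"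
    "foldl \<delta> q0 u = q" "foldl \<delta> q z \<in> F" "foldl \<delta> q v = q" "foldl \<delta> q w = q"
    "length v = length w" "v \<noteq> w"
proof -
  obtain M :: "(nat, nat) dfa" where wf: "wf_dfa {..<k} M"
    and M: "accepted {..<k} M = canonical_expansion k ` S"
    using assms(2) unfolding automatic_def regular_def by blast
  define \<delta> q0 F where "\<delta> = trans M" and "q0 = init M" and "F = final M"
  have acc: "w \<in> canonical_expansion k ` S \<longleftrightarrow> w \<in> lists {..<k} \<and> foldl \<delta> q0 w \<in> F" for w
    unfolding M[symmetric] by (simp add: accepted_def \<delta>_def q0_def F_def)
  have val: "word_val k w \<in> S" if w: "w \<in> lists {..<k}" "foldl \<delta> q0 w \<in> F" for w
  proof -
    obtain s where "s \<in> S" "w = canonical_expansion k s" using acc[of w] w by blast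
    then show ?thesis
      using canonical_word_canonical_expansion[OF \<open>k \<ge> 2\<close>, of s]
      by (simp add: canonical_word_def word_val_def)
  qed
  \<comment> \<open>The useful states: reachable from the start and able to reach acceptance. Every
    prefix of an accepted word ends in one, so accepted words run inside \<open>X\<close>, and a
    loop at such a state can be framed by \<open>u\<close> and \<open>z\<close>.\<close>
  define X where "X = {q \<in> states M. \<exists>u\<in>lists {..<k}. \<exists>z\<in>lists {..<k}. foldl \<delta> q0 u = q \<and> foldl \<delta> q z \<in> F}"
  have "finite X" using wf by (simp add: X_def wf_dfa_def)
  have state: "foldl \<delta> p u \<in> states M" if "p \<in> states M" "u \<in> lists {..<k}" for p u
    using that wf by (induction u arbitrary: p) (auto simp: wf_dfa_def \<delta>_def)
  have run: "{w \<in> canonical_expansion k ` S. length w = n} \<subseteq> runs {..<k} \<delta> X q0 n" for n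
  proof
    fix w assume "w \<in> {w \<in> canonical_expansion k ` S. length w = n}"
    then have w: "w \<in> lists {..<k}" "foldl \<delta> q0 w \<in> F" "length w = n" using acc by auto
    have "foldl \<delta> q0 u \<in> X" if "w = u @ v" for u v
      using w that state wf unfolding X_def by (auto simp: wf_dfa_def q0_def)
    then show "w \<in> runs {..<k} \<delta> X q0 n" using w by (auto simp: runs_def run_in_iff)
  qed
  have fin: "finite (runs {..<k} \<delta> X q0 n)" for n
    by (rule finite_subset[OF _ finite_lists_length_eq[of "{..<k}" n]]) (auto simp: runs_def)
  have "\<exists>q\<in>X. \<exists>v\<in>lists {..<k}. \<exists>w\<in>lists {..<k}. length v = length w \<and>
           foldl \<delta> q v = q \<and> foldl \<delta> q w = q \<and> v \<noteq> w"
  proof (rule ccontr)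
    assume no: "\<not> ?thesis"
    have "card (runs {..<k} \<delta> X q0 n) \<le> (card {..<k} * n + 1) ^ card X" for n
      by (rule card_runs_le) (use no \<open>finite X\<close> in \<open>blast+\<close>)
    then have "card {w \<in> canonical_expansion k ` S. length w = n} \<le> (card {..<k} * n + 1) ^ card X" for n
      using card_mono[OF fin run] order_trans by blast
    from sparse_if_polynomial_growth[OF \<open>k \<ge> 2\<close> this] assms(3) show False by blast
  qed
  then obtain q v w where "q \<in> X" and vw: "v \<in> lists {..<k}" "w \<in> lists {..<k}"
    "foldl \<delta> q v = q" "foldl \<delta> q w = q" "length v = length w" "v \<noteq> w" by blast
  from \<open>q \<in> X\<close> obtain u z where
    uz: "u \<in> lists {..<k}" "z \<in> lists {..<k}" "foldl \<delta> q0 u = q" "foldl \<delta> q z \<in> F"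
    unfolding X_def by blast
  show ?thesis by (rule that[OF val uz(1,2) vw(1,2) uz(3,4) vw(3-6)])
qed

theorem mainTheorem4:
  fixes k :: nat and S :: "nat set"
  assumes "k \<ge> 2" and "automatic k S"
  shows "(additive_basis S \<longrightarrow> 1 \<in> S) \<and>
         (\<not> sparse S \<and> Gcd S = 1 \<and> 1 \<in> S \<longrightarrow> additive_basis S) \<and>
         (additive_basis S \<longrightarrow> \<not> sparse S \<and> Gcd S = 1 \<and> 1 \<in> S)"
proof -
  have one: "1 \<in> S" if "additive_basis S"
    using that one_mem_if_sum_of_at_most_one unfolding additive_basis_iff by blast
  have gcd: "Gcd S = 1" if "1 \<in> S"
    using Gcd_dvd[OF that] by simp
  have suff: "additive_basis S" if "\<not> sparse S" "1 \<in> S"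
  proof -
    obtain \<delta> :: "nat \<Rightarrow> nat \<Rightarrow> nat" and q0 F q u z v w where *:
      "\<And>w. w \<in> lists {..<k} \<Longrightarrow> foldl \<delta> q0 w \<in> F \<Longrightarrow> word_val k w \<in> S"
      "u \<in> lists {..<k}" "z \<in> lists {..<k}" "v \<in> lists {..<k}" "w \<in> lists {..<k}"
      "foldl \<delta> q0 u = q" "foldl \<delta> q z \<in> F" "foldl \<delta> q v = q" "foldl \<delta> q w = q"
      "length v = length w" "v \<noteq> w"
      by (rule two_loops_if_automatic_not_sparse[OF assms \<open>\<not> sparse S\<close>]) blast
    \<comment> \<open>Distinct loops of equal length have distinct values; the loops are
      interchangeable, so either one may serve as the smaller digit.\<close>
    have "word_val k v \<noteq> word_val k w" using word_val_inj * by blast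
    then consider "word_val k v < word_val k w" | "word_val k w < word_val k v" by linarith
    then show ?thesis
    proof cases
      case 1
      show ?thesis
        by (rule additive_basis_if_two_loops[OF \<open>k \<ge> 2\<close> \<open>1 \<in> S\<close> *(1-10) 1])
    next
      case 2
      show ?thesis
        by (rule additive_basis_if_two_loops[OF \<open>k \<ge> 2\<close> \<open>1 \<in> S\<close> *(1-3,5,4,6,7,9,8) *(10)[symmetric] 2])
    qed
  qed
  show ?thesis
    using one gcd suff not_sparse_if_additive_basis by blast
qed

end
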